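(* Let $m,n\ge 1$ be integers and let $A=[A_{i,j}]_{i,j=1}^m\in \mathbb{M}_m(\mathbb{M}_n)$ be positive semidefinite. Then \[ (\mathrm{tr}\,A)I_{mn}+(\mathrm{tr}_2 A)\otimes I_n+I_m\otimes(\mathrm{tr}_1 A)+A\ \ge\ 2(\mathrm{tr}_2 D_A)\otimes I_n+2D_A, \] where $D_A=A_{1,1}\oplus A_{2,2}\oplus\cdots\oplus A_{m,m}$.
   Context: $\mathbb{M}_n$ is the space of $n\times n$ complex matrices. $\mathbb{M}_m(\mathbb{M}_n)$ is the set of $m\times m$ block matrices $A=[A_{i,j}]_{i,j=1}^m$ with blocks $A_{i,j}\in\mathbb{M}_n$, regarded also as $mn\times mn$ complex matrices. For Hermitian $X,Y$ of the same size, $X\ge Y$ means $X-Y$ is positive semidefinite. $\mathrm{tr}$ is the usual trace. The partial traces are $\mathrm{tr}_1 A=\sum_{i=1}^m A_{i,i}\in\mathbb{M}_n$ and $\mathrm{tr}_2 A=[\mathrm{tr}\,A_{i,j}]_{i,j=1}^m\in\mathbb{M}_m$. $\otimes$ is the Kronecker product: for $X=[x_{i,j}]\in\mathbb{M}_m$ and $Y\in\mathbb{M}_n$, $X\otimes Y\in\mathbb{M}_m(\mathbb{M}_n)$ has $(i,j)$ block $x_{i,j}Y$. $\oplus$ is the block-diagonal direct sum; $D_A$ is regarded as an element of $\mathbb{M}_m(\mathbb{M}_n)$. *)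

theory Defs
  imports "HOL-Analysis.Analysis"
begin

text \<open>
  A block matrix in \<open>M_m(M_n)\<close>, regarded as an \<open>mn \<times> mn\<close> matrix, is a matrix indexed by pairs:
  the row index \<open>(i, k)\<close> is row \<open>k\<close> of block row \<open>i\<close>, and similarly for columns.
  The sizes are \<open>m = CARD('m)\<close> and \<open>n = CARD('n)\<close>, which are at least 1 because types are nonempty.
\<close>

type_synonym ('m, 'n) block_matrix = "complex ^ ('m \<times> 'n) ^ ('m \<times> 'n)"

definition block :: "('m::finite, 'n::finite) block_matrix \<Rightarrow> 'm \<Rightarrow> 'm \<Rightarrow> complex ^ 'n ^ 'n"
  where "block A i j = (\<chi> k l. A $ (i, k) $ (j, l))"

definition ptrace1 :: "('m::finite, 'n::finite) block_matrix \<Rightarrow> complex ^ 'n ^ 'n"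
  where "ptrace1 A = (\<Sum>i\<in>UNIV. block A i i)"

definition ptrace2 :: "('m::finite, 'n::finite) block_matrix \<Rightarrow> complex ^ 'm ^ 'm"
  where "ptrace2 A = (\<chi> i j. trace (block A i j))"

definition kronecker ::
    "complex ^ 'm ^ 'm \<Rightarrow> complex ^ 'n ^ 'n \<Rightarrow> ('m::finite, 'n::finite) block_matrix"
    (infixl "\<otimes>\<^sub>K" 70)
  where "X \<otimes>\<^sub>K Y = (\<chi> p q. X $ fst p $ fst q * Y $ snd p $ snd q)"

definition direct_sum :: "('m \<Rightarrow> complex ^ 'n ^ 'n) \<Rightarrow> ('m::finite, 'n::finite) block_matrix"
  where "direct_sum B = (\<chi> p q. if fst p = fst q then B (fst p) $ snd p $ snd q else 0)"

definition diag_blocks :: "('m::finite, 'n::finite) block_matrix \<Rightarrow> ('m, 'n) block_matrix"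
  where "diag_blocks A = direct_sum (\<lambda>i. block A i i)"

definition hermitian :: "complex ^ 'k ^ 'k::finite \<Rightarrow> bool"
  where "hermitian X \<longleftrightarrow> (\<chi> i j. cnj (X $ j $ i)) = X"

text \<open>
  For a Hermitian matrix \<open>X\<close> the form \<open>x\<^sup>* X x\<close> is real, so taking its real part loses nothing.
\<close>

definition psd :: "complex ^ 'k ^ 'k::finite \<Rightarrow> bool"
  where "psd X \<longleftrightarrow> hermitian X \<and> (\<forall>x. 0 \<le> Re (\<Sum>i\<in>UNIV. cnj (x $ i) * (X *v x) $ i))"

text \<open>
  The Loewner order is only meaningful between Hermitian matrices, so both sides are required
  to be Hermitian.
\<close>

definition loewner_ge :: "complex ^ 'k ^ 'k::finite \<Rightarrow> complex ^ 'k ^ 'k \<Rightarrow> bool"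
    (infix "\<ge>\<^sub>L" 50)
  where "X \<ge>\<^sub>L Y \<longleftrightarrow> hermitian X \<and> hermitian Y \<and> psd (X - Y)"

end

theory Submission
  imports Defs
begin

text \<open>
  Write \<open>Q(x) = x\<^sup>* (L - R) x\<close> for the difference of the two sides, with \<open>x\<close> indexed by pairs.
  For \<open>A = v v\<^sup>*\<close> every term of \<open>Q(x)\<close> belongs to a pair \<open>i, j\<close> of block indices. The terms with
  \<open>i = j\<close> cancel, and the others combine to the sum of
  \<open>\<bar>v\<^sub>i\<^sub>k x\<^sub>j\<^sub>l + v\<^sub>j\<^sub>k x\<^sub>i\<^sub>l + v\<^sub>i\<^sub>l x\<^sub>j\<^sub>k + v\<^sub>j\<^sub>l x\<^sub>i\<^sub>k\<bar>\<^sup>2 / 4\<close> over all \<open>i \<noteq> j\<close> and all \<open>k, l\<close>.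
  Each expression under the modulus is linear in \<open>v\<close>, so the identity
  has a version for an arbitrary matrix \<open>A\<close>, with no spectral decomposition:
  \<open>4 Q(x) = \<Sum> u\<^sup>* A u\<close>, where \<open>u\<close> runs over the vectors \<open>symm_vec x i j k l\<close> built from \<open>x\<close>
  (lemma \<open>four_form_difference\<close>). If \<open>A\<close> is positive semidefinite, every summand is nonnegative.

  The identity itself comes from symmetry: \<open>symm_vec\<close> is the sum of the four images of one vector
  \<open>corner_vec x i j k l\<close> under the swaps \<open>i \<leftrightarrow> j\<close> and \<open>k \<leftrightarrow> l\<close>, so the sixteen terms of
  \<open>u\<^sup>* A u\<close> fall, after summation, into four groups of four equal ones, and the four groups are
  the four matrices on the left, each without its part with \<open>i = j\<close>; that part is what \<open>R\<close> subtracts.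
\<close>

section \<open>Sesquilinear forms of matrices\<close>

definition form :: "complex ^ 'k ^ 'k::finite \<Rightarrow> complex ^ 'k \<Rightarrow> complex ^ 'k \<Rightarrow> complex"
  where "form X y z = (\<Sum>p\<in>UNIV. \<Sum>q\<in>UNIV. cnj (y $ p) * X $ p $ q * z $ q)"

lemma psd_iff_form: "psd X \<longleftrightarrow> hermitian X \<and> (\<forall>x. 0 \<le> Re (form X x x))"
  by (simp add: psd_def form_def matrix_vector_mult_def sum_distrib_left mult.assoc)

lemma form_add_matrix: "form (X + Y) y z = form X y z + form Y y z"
  by (simp add: form_def algebra_simps sum.distrib)

lemma form_diff_matrix: "form (X - Y) y z = form X y z - form Y y z"
  by (simp add: form_def algebra_simps sum_subtractf)

lemma form_scaleR_matrix: "form (c *\<^sub>R X) y z = c *\<^sub>R form X y z"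
  by (simp add: form_def scaleR_sum_right)

lemma form_add_left: "form X (y + y') z = form X y z + form X y' z"
  by (simp add: form_def algebra_simps sum.distrib)

lemma form_add_right: "form X y (z + z') = form X y z + form X y z'"
  by (simp add: form_def algebra_simps sum.distrib)

lemma form_zero_left [simp]: "form X 0 z = 0"
  by (simp add: form_def)

lemma form_zero_right [simp]: "form X y 0 = 0"
  by (simp add: form_def)

lemma form_axis: "form X (axis p a) (axis q b) = cnj a * X $ p $ q * b"
proof -
  have "form X (axis p a) (axis q b)
      = (\<Sum>r\<in>UNIV. \<Sum>s\<in>UNIV. if s = q then (if r = p then cnj a * X $ p $ q * b else 0) else 0)"
    unfolding form_def by (intro sum.cong refl) (auto simp: axis_def)
  then show ?thesis by simp
qed

lemma sum_UNIV_pairs: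
  "(\<Sum>p\<in>UNIV. f p) = (\<Sum>i\<in>UNIV. \<Sum>k\<in>UNIV. f (i :: 'm::finite, k :: 'n::finite))"
  by (simp add: sum.cartesian_product UNIV_Times_UNIV)

lemma form_pairs:
  "form X y z = (\<Sum>i\<in>UNIV. \<Sum>k\<in>UNIV. \<Sum>j\<in>UNIV. \<Sum>l\<in>UNIV.
     cnj (y $ (i, k)) * X $ (i, k) $ (j, l) * z $ (j, l))"
  for X :: "('m::finite, 'n::finite) block_matrix"
  by (simp add: form_def sum_UNIV_pairs)

section \<open>Quadruple sums over two block indices and two inner indices\<close>

definition sum4 :: "('m::finite \<Rightarrow> 'm \<Rightarrow> 'n::finite \<Rightarrow> 'n \<Rightarrow> complex) \<Rightarrow> complex"
  where "sum4 f = (\<Sum>i\<in>UNIV. \<Sum>j\<in>UNIV. \<Sum>k\<in>UNIV. \<Sum>l\<in>UNIV. f i j k l)"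

lemma sum4_add: "sum4 (\<lambda>i j k l. f i j k l + g i j k l) = sum4 f + sum4 g"
  by (simp add: sum4_def sum.distrib)

lemma sum4_diff: "sum4 (\<lambda>i j k l. f i j k l - g i j k l) = sum4 f - sum4 g"
  by (simp add: sum4_def sum_subtractf)

lemma sum4_swap_blocks: "sum4 (\<lambda>i j k l. f j i k l) = sum4 f"
  unfolding sum4_def by (rule sum.swap)

lemma sum4_swap_inner: "sum4 (\<lambda>i j k l. f i j l k) = sum4 f"
  unfolding sum4_def by (rule sum.cong [OF refl], rule sum.cong [OF refl], rule sum.swap)

lemma sum4_diagonal:
  "sum4 (\<lambda>i j k l. if i = j then f i j k l else 0)
     = (\<Sum>i\<in>UNIV. \<Sum>k\<in>UNIV. \<Sum>l\<in>UNIV. f i i k l)"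
proof -
  have "sum4 (\<lambda>i j k l. if i = j then f i j k l else 0)
      = (\<Sum>i\<in>UNIV. \<Sum>j\<in>UNIV. if i = j then \<Sum>k\<in>UNIV. \<Sum>l\<in>UNIV. f i j k l else 0)"
    unfolding sum4_def by (intro sum.cong refl) auto
  then show ?thesis by simp
qed

section \<open>The forms of the matrices in the inequality\<close>

lemma form_mat_trace:
  fixes A :: "('m::finite, 'n::finite) block_matrix"
  shows "form (mat (trace A)) x x
    = sum4 (\<lambda>i j k l. x $ (j, l) * cnj (x $ (j, l)) * A $ (i, k) $ (i, k))"
proof -
  have "form (mat (trace A)) x x = (\<Sum>p\<in>UNIV. cnj (x $ p) * trace A * x $ p)"
    by (simp add: form_def mat_def if_distrib if_distribR cong: if_cong)
  also have "\<dots> = trace A * (\<Sum>p\<in>UNIV. x $ p * cnj (x $ p))"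
    by (simp add: sum_distrib_left mult_ac)
  also have "\<dots> = (\<Sum>i\<in>UNIV. \<Sum>k\<in>UNIV.
      A $ (i, k) $ (i, k) * (\<Sum>j\<in>UNIV. \<Sum>l\<in>UNIV. x $ (j, l) * cnj (x $ (j, l))))"
    by (simp add: trace_def sum_UNIV_pairs sum_distrib_right)
  also have "\<dots> = (\<Sum>i\<in>UNIV. \<Sum>k\<in>UNIV. \<Sum>j\<in>UNIV. \<Sum>l\<in>UNIV.
      x $ (j, l) * cnj (x $ (j, l)) * A $ (i, k) $ (i, k))"
    by (simp add: sum_distrib_left mult_ac)
  also have "\<dots> = sum4 (\<lambda>i j k l. x $ (j, l) * cnj (x $ (j, l)) * A $ (i, k) $ (i, k))"
    unfolding sum4_def by (rule sum.cong [OF refl], rule sum.swap)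
  finally show ?thesis .
qed

lemma form_kronecker_mat_1:
  "form (X \<otimes>\<^sub>K mat 1) x x
     = (\<Sum>i\<in>UNIV. \<Sum>j\<in>UNIV. \<Sum>l\<in>UNIV. x $ (j, l) * cnj (x $ (i, l)) * X $ i $ j)"
proof -
  have "form (X \<otimes>\<^sub>K mat 1) x x = (\<Sum>i\<in>UNIV. \<Sum>l\<in>UNIV. \<Sum>j\<in>UNIV.
      x $ (j, l) * cnj (x $ (i, l)) * X $ i $ j)"
    by (simp add: form_pairs kronecker_def mat_def if_distrib if_distribR mult_ac cong: if_cong)
  also have "\<dots> = (\<Sum>i\<in>UNIV. \<Sum>j\<in>UNIV. \<Sum>l\<in>UNIV. x $ (j, l) * cnj (x $ (i, l)) * X $ i $ j)"
    by (rule sum.cong [OF refl], rule sum.swap)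
  finally show ?thesis .
qed

lemma form_mat_1_kronecker:
  "form (mat 1 \<otimes>\<^sub>K Y) x x
     = (\<Sum>j\<in>UNIV. \<Sum>k\<in>UNIV. \<Sum>l\<in>UNIV. x $ (j, l) * cnj (x $ (j, k)) * Y $ k $ l)"
proof -
  have "form (mat 1 \<otimes>\<^sub>K Y) x x = (\<Sum>i\<in>UNIV. \<Sum>k\<in>UNIV. \<Sum>j\<in>UNIV.
      if i = j then \<Sum>l\<in>UNIV. x $ (j, l) * cnj (x $ (i, k)) * Y $ k $ l else 0)"
    unfolding form_pairs
    by (intro sum.cong refl) (auto simp: kronecker_def mat_def mult_ac)
  then show ?thesis by simp
qed

lemma form_ptrace2_kronecker:
  "form (ptrace2 A \<otimes>\<^sub>K mat 1) x x
     = sum4 (\<lambda>i j k l. x $ (j, l) * cnj (x $ (i, l)) * A $ (i, k) $ (j, k))"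
proof -
  have "form (ptrace2 A \<otimes>\<^sub>K mat 1) x x
      = sum4 (\<lambda>i j l k. x $ (j, l) * cnj (x $ (i, l)) * A $ (i, k) $ (j, k))"
    by (simp add: form_kronecker_mat_1 ptrace2_def trace_def block_def sum4_def sum_distrib_left)
  also have "\<dots> = sum4 (\<lambda>i j k l. x $ (j, l) * cnj (x $ (i, l)) * A $ (i, k) $ (j, k))"
    by (rule sum4_swap_inner)
  finally show ?thesis .
qed

lemma form_kronecker_ptrace1:
  "form (mat 1 \<otimes>\<^sub>K ptrace1 A) x x
     = sum4 (\<lambda>i j k l. x $ (j, l) * cnj (x $ (j, k)) * A $ (i, k) $ (i, l))"
proof -
  have "form (mat 1 \<otimes>\<^sub>K ptrace1 A) x x = (\<Sum>j\<in>UNIV. \<Sum>k\<in>UNIV. \<Sum>l\<in>UNIV. \<Sum>i\<in>UNIV.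
      x $ (j, l) * cnj (x $ (j, k)) * A $ (i, k) $ (i, l))"
    by (simp add: form_mat_1_kronecker ptrace1_def block_def sum_distrib_left)
  also have "\<dots> = (\<Sum>j\<in>UNIV. \<Sum>k\<in>UNIV. \<Sum>i\<in>UNIV. \<Sum>l\<in>UNIV.
      x $ (j, l) * cnj (x $ (j, k)) * A $ (i, k) $ (i, l))"
    by (rule sum.cong [OF refl], rule sum.cong [OF refl], rule sum.swap)
  also have "\<dots> = sum4 (\<lambda>j i k l. x $ (j, l) * cnj (x $ (j, k)) * A $ (i, k) $ (i, l))"
    unfolding sum4_def by (rule sum.cong [OF refl], rule sum.swap)
  also have "\<dots> = sum4 (\<lambda>i j k l. x $ (j, l) * cnj (x $ (j, k)) * A $ (i, k) $ (i, l))"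
    by (rule sum4_swap_blocks)
  finally show ?thesis .
qed

lemma form_sum4:
  "form A x x = sum4 (\<lambda>i j k l. x $ (j, l) * cnj (x $ (i, k)) * A $ (i, k) $ (j, l))"
proof -
  have "form A x x = (\<Sum>i\<in>UNIV. \<Sum>k\<in>UNIV. \<Sum>j\<in>UNIV. \<Sum>l\<in>UNIV.
      x $ (j, l) * cnj (x $ (i, k)) * A $ (i, k) $ (j, l))"
    by (simp add: form_pairs mult_ac)
  also have "\<dots> = sum4 (\<lambda>i j k l. x $ (j, l) * cnj (x $ (i, k)) * A $ (i, k) $ (j, l))"
    unfolding sum4_def by (rule sum.cong [OF refl], rule sum.swap)
  finally show ?thesis .
qed

lemma diag_blocks_nth:
  "diag_blocks A $ (i, k) $ (j, l) = (if i = j then A $ (i, k) $ (j, l) else 0)"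
  by (simp add: diag_blocks_def direct_sum_def block_def)

lemma form_ptrace2_diag_blocks_kronecker:
  fixes A :: "('m::finite, 'n::finite) block_matrix" and x :: "complex ^ ('m \<times> 'n)"
  shows "form (ptrace2 (diag_blocks A) \<otimes>\<^sub>K mat 1) x x
     = (\<Sum>i\<in>UNIV. \<Sum>k\<in>UNIV. \<Sum>l\<in>UNIV. x $ (i, l) * cnj (x $ (i, l)) * A $ (i, k) $ (i, k))"
proof -
  have "form (ptrace2 (diag_blocks A) \<otimes>\<^sub>K mat 1) x x
      = sum4 (\<lambda>i j k l. if i = j then x $ (j, l) * cnj (x $ (i, l)) * A $ (i, k) $ (j, k) else 0)"
    unfolding form_ptrace2_kronecker
    by (rule arg_cong [where f = sum4]) (auto simp: fun_eq_iff diag_blocks_nth)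
  then show ?thesis by (simp only: sum4_diagonal)
qed

lemma form_diag_blocks:
  "form (diag_blocks A) x x
     = (\<Sum>i\<in>UNIV. \<Sum>k\<in>UNIV. \<Sum>l\<in>UNIV. x $ (i, l) * cnj (x $ (i, k)) * A $ (i, k) $ (i, l))"
proof -
  have "form (diag_blocks A) x x
      = sum4 (\<lambda>i j k l. if i = j then x $ (j, l) * cnj (x $ (i, k)) * A $ (i, k) $ (j, l) else 0)"
    unfolding form_sum4
    by (rule arg_cong [where f = sum4]) (auto simp: fun_eq_iff diag_blocks_nth)
  then show ?thesis by (simp only: sum4_diagonal)
qed

section \<open>The sum of squares\<close>

text \<open>
  Vanishing for \<open>i = j\<close> builds the restriction to distinct block indices into the vectors, so
  that sums may run over all index pairs.
\<close>

definition corner_vec ::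
    "complex ^ ('m \<times> 'n) \<Rightarrow> 'm::finite \<Rightarrow> 'm \<Rightarrow> 'n::finite \<Rightarrow> 'n \<Rightarrow> complex ^ ('m \<times> 'n)"
  where "corner_vec x i j k l = (if i = j then 0 else axis (i, k) (cnj (x $ (j, l))))"

definition symm_vec ::
    "complex ^ ('m \<times> 'n) \<Rightarrow> 'm::finite \<Rightarrow> 'm \<Rightarrow> 'n::finite \<Rightarrow> 'n \<Rightarrow> complex ^ ('m \<times> 'n)"
  where "symm_vec x i j k l =
    corner_vec x i j k l + corner_vec x j i k l + corner_vec x i j l k + corner_vec x j i l k"

lemma symm_vec_swap_blocks: "symm_vec x j i k l = symm_vec x i j k l"
  by (simp add: symm_vec_def add_ac)

lemma symm_vec_swap_inner: "symm_vec x i j l k = symm_vec x i j k l"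
  by (simp add: symm_vec_def add_ac)

text \<open>
  Expand only the left argument. The right one is invariant under both swaps, so renaming the
  summation indices turns each of the four resulting sums into the first.
\<close>

lemma sum4_form_symm_vec:
  "sum4 (\<lambda>i j k l. form A (symm_vec x i j k l) (symm_vec x i j k l))
     = 4 * sum4 (\<lambda>i j k l. form A (corner_vec x i j k l) (symm_vec x i j k l))"
proof -
  let ?f = "\<lambda>i j k l. form A (corner_vec x i j k l) (symm_vec x i j k l)"
  have "form A (symm_vec x i j k l) (symm_vec x i j k l)
      = ?f i j k l + ?f j i k l + ?f i j l k + ?f j i l k" for i j k l
    unfolding symm_vec_swap_blocks [of x j i] symm_vec_swap_inner [of x i j l k]
    by (subst (1) symm_vec_def) (simp only: form_add_left)
  moreover have "sum4 (\<lambda>i j k l. ?f j i l k) = sum4 ?f"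
    using sum4_swap_blocks [of "\<lambda>i j k l. ?f i j l k"] sum4_swap_inner [of ?f] by simp
  ultimately show ?thesis
    using sum4_swap_blocks [of ?f] sum4_swap_inner [of ?f] by (simp add: sum4_add)
qed

lemma form_corner_symm_vec:
  "form A (corner_vec x i j k l) (symm_vec x i j k l) =
    (if i = j then 0 else
       x $ (j, l) * cnj (x $ (j, l)) * A $ (i, k) $ (i, k)
     + x $ (j, l) * cnj (x $ (i, l)) * A $ (i, k) $ (j, k)
     + x $ (j, l) * cnj (x $ (j, k)) * A $ (i, k) $ (i, l)
     + x $ (j, l) * cnj (x $ (i, k)) * A $ (i, k) $ (j, l))"
  by (simp add: symm_vec_def form_add_right corner_vec_def form_axis mult_ac)

text \<open>
  For \<open>i = j\<close> the first two of the four terms coincide, and so do the last two; this is where the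
  two factors 2 on the right-hand side of the inequality come from.
\<close>

lemma four_form_difference:
  fixes A :: "('m::finite, 'n::finite) block_matrix"
  shows "4 * form (mat (trace A) + ptrace2 A \<otimes>\<^sub>K mat 1 + mat 1 \<otimes>\<^sub>K ptrace1 A + A
      - (2 *\<^sub>R (ptrace2 (diag_blocks A) \<otimes>\<^sub>K mat 1) + 2 *\<^sub>R diag_blocks A)) x x
    = sum4 (\<lambda>i j k l. form A (symm_vec x i j k l) (symm_vec x i j k l))"
proof -
  define t where "t i j k l =
       x $ (j, l) * cnj (x $ (j, l)) * A $ (i, k) $ (i, k)
     + x $ (j, l) * cnj (x $ (i, l)) * A $ (i, k) $ (j, k)
     + x $ (j, l) * cnj (x $ (j, k)) * A $ (i, k) $ (i, l)
     + x $ (j, l) * cnj (x $ (i, k)) * A $ (i, k) $ (j, l)" for i j k l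
  have "sum4 (\<lambda>i j k l. form A (corner_vec x i j k l) (symm_vec x i j k l))
      = sum4 (\<lambda>i j k l. t i j k l - (if i = j then t i j k l else 0))"
    by (rule arg_cong [where f = sum4]) (auto simp: fun_eq_iff form_corner_symm_vec t_def)
  also have "\<dots> = sum4 t - (\<Sum>i\<in>UNIV. \<Sum>k\<in>UNIV. \<Sum>l\<in>UNIV. t i i k l)"
    by (simp only: sum4_diff sum4_diagonal)
  also have "sum4 t = form (mat (trace A) + ptrace2 A \<otimes>\<^sub>K mat 1 + mat 1 \<otimes>\<^sub>K ptrace1 A + A) x x"
    by (simp only: form_add_matrix form_mat_trace form_ptrace2_kronecker form_kronecker_ptrace1
      form_sum4 [of A] t_def [abs_def] sum4_add)
  also have "(\<Sum>i\<in>UNIV. \<Sum>k\<in>UNIV. \<Sum>l\<in>UNIV. t i i k l)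
      = form (2 *\<^sub>R (ptrace2 (diag_blocks A) \<otimes>\<^sub>K mat 1) + 2 *\<^sub>R diag_blocks A) x x"
    unfolding form_add_matrix form_scaleR_matrix form_ptrace2_diag_blocks_kronecker
      form_diag_blocks t_def scaleR_2
    by (simp only: sum.distrib add.assoc)
  finally show ?thesis
    by (simp only: form_diff_matrix sum4_form_symm_vec)
qed

section \<open>Hermitian matrices and the inequality\<close>

lemma hermitian_iff: "hermitian X \<longleftrightarrow> (\<forall>i j. cnj (X $ j $ i) = X $ i $ j)"
  by (simp add: hermitian_def vec_eq_iff)

lemma hermitian_add: "hermitian X \<Longrightarrow> hermitian Y \<Longrightarrow> hermitian (X + Y)"
  by (simp add: hermitian_iff)

lemma hermitian_diff: "hermitian X \<Longrightarrow> hermitian Y \<Longrightarrow> hermitian (X - Y)"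
  by (simp add: hermitian_iff)

lemma hermitian_scaleR: "hermitian X \<Longrightarrow> hermitian (c *\<^sub>R X)"
  by (simp add: hermitian_iff)

lemma hermitian_mat: "cnj c = c \<Longrightarrow> hermitian (mat c)"
  by (simp add: hermitian_iff mat_def)

lemma cnj_trace_hermitian: "hermitian X \<Longrightarrow> cnj (trace X) = trace X"
  by (simp add: hermitian_iff trace_def)

lemma hermitian_kronecker: "hermitian X \<Longrightarrow> hermitian Y \<Longrightarrow> hermitian (X \<otimes>\<^sub>K Y)"
  by (simp add: hermitian_iff kronecker_def)

lemma hermitian_ptrace1: "hermitian A \<Longrightarrow> hermitian (ptrace1 A)"
  by (simp add: hermitian_iff ptrace1_def block_def)

lemma hermitian_ptrace2: "hermitian A \<Longrightarrow> hermitian (ptrace2 A)"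
  by (simp add: hermitian_iff ptrace2_def trace_def block_def)

lemma hermitian_diag_blocks: "hermitian A \<Longrightarrow> hermitian (diag_blocks A)"
  by (simp add: hermitian_iff diag_blocks_nth split_paired_all)

theorem theorem4p3:
  fixes A :: "('m::finite, 'n::finite) block_matrix"
  assumes "psd A"
  shows "mat (trace A) + ptrace2 A \<otimes>\<^sub>K mat 1 + mat 1 \<otimes>\<^sub>K ptrace1 A + A
    \<ge>\<^sub>L 2 *\<^sub>R (ptrace2 (diag_blocks A) \<otimes>\<^sub>K mat 1) + 2 *\<^sub>R diag_blocks A"
    (is "?L \<ge>\<^sub>L ?R")
proof -
  have A: "hermitian A" and nonneg: "0 \<le> Re (form A u u)" for u
    using assms by (auto simp: psd_iff_form)
  have L: "hermitian ?L"
    by (intro hermitian_add hermitian_mat hermitian_kronecker hermitian_ptrace1 hermitian_ptrace2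
      cnj_trace_hermitian A complex_cnj_one)
  have R: "hermitian ?R"
    by (intro hermitian_add hermitian_scaleR hermitian_mat hermitian_kronecker hermitian_ptrace2
      hermitian_diag_blocks A complex_cnj_one)
  have "0 \<le> Re (form (?L - ?R) x x)" for x
  proof -
    have "0 \<le> Re (sum4 (\<lambda>i j k l. form A (symm_vec x i j k l) (symm_vec x i j k l)))"
      unfolding sum4_def Re_sum by (intro sum_nonneg nonneg)
    also have "\<dots> = Re (4 * form (?L - ?R) x x)"
      by (simp only: four_form_difference)
    finally show ?thesis by simp
  qed
  then show ?thesis
    using L R by (simp add: loewner_ge_def psd_iff_form hermitian_diff)
qed

end
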